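(* Let $u^n$ be the solution of the single step time stepping scheme given by the two-stage Lobatto IIIC method with step size $\Delta t$, applied to $u'(t)+Au(t)=f(t)$, $0<t<T$, $u(0)=u^0$, and let $U_k^n$ be the solution obtained from the parareal algorithm with the backward Euler method (step size $\Delta T=J\Delta t$) as coarse propagator and this two-stage Lobatto IIIC scheme as fine propagator (all defined in the context). Then for all integers $J\ge2$ there holds $$\max_{1\le n\le N_c}\|U_k^n-u^{nJ}\|\le c\,\gamma^k\quad\text{with}\quad\gamma=0.31,$$ where $c$ denotes a constant.
   Context: $H$ is a Hilbert space with norm $\|\cdot\|$; $A$ is a positive definite, selfadjoint, linear operator with compact inverse, defined in $H$ with domain $D(A)$ dense in $H$; $T>0$; $u^0\in H$ is a given initial condition and $f:[0,T]\to H$ a given forcing term, with $f\in C([0,T];H)$ in the definition of the propagators below. Functions of $A$ such as $r(-\Delta t A)$ are defined by the spectral decomposition of $A$; $I$ is the identity. Two-stage Lobatto IIIC method ($m=2$): Runge–Kutta matrix $M=\begin{pmatrix}\frac12&-\frac12\\ \frac12&\frac12\end{pmatrix}$, weights $b=(\frac12,\frac12)^\top$, nodes $c_1=0$, $c_2=1$. Its rational functions are $r(z)=1+z\,b^\top(I-zM)^{-1}\mathbf 1$ with $\mathbf 1=(1,1)^\top$, and $(p_1(z),\dots,p_m(z))=b^\top(I-zM)^{-1}$. In particular $r(-s)=\frac{2}{s^2+2s+2}$. Grids: $\Delta t=T/N$, $t_n=n\Delta t$; $\Delta T=J\Delta t$, $N_c=T/\Delta T$ is assumed to be an integer (so $N=JN_c$),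 $T_n=n\Delta T$. Single step scheme: starting from the given $u^0$, $$u^{n+1}=r(-\Delta t A)u^n+\Delta t\sum_{i=1}^m p_i(-\Delta t A)f(t_n+c_i\Delta t),\qquad 0\le n\le N-1.$$ Coarse propagator (backward Euler): $\mathcal G(T_n,\Delta T,v,f)=(I+\Delta T A)^{-1}(v+\Delta T f(T_n))$. Fine propagator: $\mathcal F(t,\Delta t,v,f)=r(-\Delta tA)v+\Delta t\sum_{i=1}^m p_i(-\Delta tA)f(t+c_i\Delta t)$. Parareal algorithm: initialize $U_0^0=u^0$, $U_0^{n+1}=\mathcal G(T_n,\Delta T,U_0^n,f)$ for $n=0,\dots,N_c-1$. For $k=0,1,2,\dots$ (until a stopping criterion is met): (Step 1) for each $n=0,\dots,N_c-1$ set $\widetilde U^{n,0}=U_k^n$, $\widetilde U^{n,j+1}=\mathcal F(T_n+j\Delta t,\Delta t,\widetilde U^{n,j},f)$ for $j=0,\dots,J-1$, and $\widetilde U^{n+1}=\widetilde U^{n,J}$; (Step 2) set $U_{k+1}^0=u^0$ and $$U_{k+1}^{n+1}=\mathcal G(T_n,\Delta T,U_{k+1}^n,f)+\widetilde U^{n+1}-\mathcal G(T_n,\Delta T,U_k^n,f),\qquad n=0,\dots,N_c-1.$$ *)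

theory Defs
  imports "HOL-Analysis.Analysis"
begin

section \<open>Unbounded operators\<close>

text \<open>
  An unbounded operator on a Hilbert space is a total function \<open>A\<close> together with its domain
  \<open>D\<close>; the values of \<open>A\<close> outside \<open>D\<close> are irrelevant.
\<close>

definition linear_operator :: "'h::real_vector set \<Rightarrow> ('h \<Rightarrow> 'h) \<Rightarrow> bool" where
  "linear_operator D A \<longleftrightarrow> subspace D \<and>
     (\<forall>x\<in>D. \<forall>y\<in>D. A (x + y) = A x + A y) \<and>
     (\<forall>a. \<forall>x\<in>D. A (a *\<^sub>R x) = a *\<^sub>R A x)"

definition densely_defined :: "'h::topological_space set \<Rightarrow> bool" where
  "densely_defined D \<longleftrightarrow> closure D = UNIV"

definition adjoint_graph :: "'h::real_inner set \<Rightarrow> ('h \<Rightarrow> 'h) \<Rightarrow> ('h \<times> 'h) set" where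
  "adjoint_graph D A = {(v, w). \<forall>u\<in>D. A u \<bullet> v = u \<bullet> w}"

text \<open>Equality of graphs, so the domain of the adjoint is required to be exactly \<open>D\<close>.\<close>

definition selfadjoint :: "'h::real_inner set \<Rightarrow> ('h \<Rightarrow> 'h) \<Rightarrow> bool" where
  "selfadjoint D A \<longleftrightarrow> adjoint_graph D A = {(v, A v) |v. v \<in> D}"

definition positive_definite :: "'h::real_inner set \<Rightarrow> ('h \<Rightarrow> 'h) \<Rightarrow> bool" where
  "positive_definite D A \<longleftrightarrow> (\<forall>v\<in>D. v \<noteq> 0 \<longrightarrow> A v \<bullet> v > 0)"

definition has_compact_inverse :: "'h::real_normed_vector set \<Rightarrow> ('h \<Rightarrow> 'h) \<Rightarrow> bool" where
  "has_compact_inverse D A \<longleftrightarrow> bij_betw A D UNIV \<and>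
     (\<forall>S. bounded S \<longrightarrow> compact (closure (inv_into D A ` S)))"

section \<open>Functions of an operator with discrete spectrum\<close>

definition eigenspace :: "'h::real_vector set \<Rightarrow> ('h \<Rightarrow> 'h) \<Rightarrow> real \<Rightarrow> 'h set" where
  "eigenspace D A l = {v \<in> D. A v = l *\<^sub>R v}"

definition orth_proj :: "'h::real_inner set \<Rightarrow> 'h \<Rightarrow> 'h" where
  "orth_proj S v = (THE p. p \<in> S \<and> (\<forall>e\<in>S. (v - p) \<bullet> e = 0))"

text \<open>
  \<open>spectral_fun D A g\<close> is \<open>g(A)\<close>. For a selfadjoint operator with compact inverse,
  \<open>A = \<Sum> l P\<^sub>l\<close>, where \<open>l\<close> runs through the eigenvalues and \<open>P\<^sub>l\<close> is the orthogonal projection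
  onto the (finite-dimensional) eigenspace; hence \<open>g(A) = \<Sum> g(l) P\<^sub>l\<close>. Summing over eigenspaces
  avoids the choice of an orthonormal eigenbasis.
\<close>

definition spectral_fun ::
    "'h::real_inner set \<Rightarrow> ('h \<Rightarrow> 'h) \<Rightarrow> (real \<Rightarrow> real) \<Rightarrow> 'h \<Rightarrow> 'h" where
  "spectral_fun D A g v =
     (\<Sum>\<^sub>\<infinity>l\<in>{l. eigenspace D A l \<noteq> {0}}. g l *\<^sub>R orth_proj (eigenspace D A l) v)"

section \<open>Runge--Kutta methods\<close>

text \<open>
  A tableau consists of the matrix \<open>M\<close>, the weights \<open>b\<close> and the nodes \<open>c\<close>; the stages are
  indexed by a finite type.
\<close>

definition rk_r :: "real^'m^'m \<Rightarrow> real^'m \<Rightarrow> real \<Rightarrow> real" where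
  "rk_r M b z = 1 + z * (b \<bullet> (matrix_inv (mat 1 - z *\<^sub>R M) *v 1))"

definition rk_p :: "real^'m^'m \<Rightarrow> real^'m \<Rightarrow> real \<Rightarrow> real^'m" where
  "rk_p M b z = b v* matrix_inv (mat 1 - z *\<^sub>R M)"

definition rk_propagator ::
    "real^'m^'m \<Rightarrow> real^'m \<Rightarrow> real^'m \<Rightarrow> 'h::real_inner set \<Rightarrow> ('h \<Rightarrow> 'h) \<Rightarrow>
     real \<Rightarrow> real \<Rightarrow> 'h \<Rightarrow> (real \<Rightarrow> 'h) \<Rightarrow> 'h" where
  "rk_propagator M b c D A t dt v f =
     spectral_fun D A (\<lambda>l. rk_r M b (- dt * l)) v +
     dt *\<^sub>R (\<Sum>i\<in>UNIV. spectral_fun D A (\<lambda>l. rk_p M b (- dt * l) $ i) (f (t + c $ i * dt)))"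

definition lobatto_matrix :: "real^2^2" where
  "lobatto_matrix = vector [vector [1/2, -1/2], vector [1/2, 1/2]]"

definition lobatto_weights :: "real^2" where
  "lobatto_weights = vector [1/2, 1/2]"

definition lobatto_nodes :: "real^2" where
  "lobatto_nodes = vector [0, 1]"

definition lobatto_propagator ::
    "'h::real_inner set \<Rightarrow> ('h \<Rightarrow> 'h) \<Rightarrow> real \<Rightarrow> real \<Rightarrow> 'h \<Rightarrow> (real \<Rightarrow> 'h) \<Rightarrow> 'h" where
  "lobatto_propagator = rk_propagator lobatto_matrix lobatto_weights lobatto_nodes"

text \<open>\<open>(I + dT A)\<inverse> (v + dT f(t))\<close>; the inverse is that of the operator \<open>I + dT A\<close> with domain \<open>D\<close>.\<close>

definition backward_euler ::
    "'h::real_vector set \<Rightarrow> ('h \<Rightarrow> 'h) \<Rightarrow> real \<Rightarrow> real \<Rightarrow> 'h \<Rightarrow> (real \<Rightarrow> 'h) \<Rightarrow> 'h" where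
  "backward_euler D A t dT v f = inv_into D (\<lambda>w. w + dT *\<^sub>R A w) (v + dT *\<^sub>R f t)"

section \<open>Time stepping and the parareal algorithm\<close>

text \<open>\<open>stepping F t dt f v j\<close> is the result of \<open>j\<close> steps of size \<open>dt\<close> from value \<open>v\<close> at time \<open>t\<close>.\<close>

primrec stepping ::
    "(real \<Rightarrow> real \<Rightarrow> 'h \<Rightarrow> (real \<Rightarrow> 'h) \<Rightarrow> 'h) \<Rightarrow> real \<Rightarrow> real \<Rightarrow> (real \<Rightarrow> 'h) \<Rightarrow> 'h \<Rightarrow> nat \<Rightarrow> 'h"
  where
    "stepping F t dt f v 0 = v"
  | "stepping F t dt f v (Suc j) = F (t + real j * dt) dt (stepping F t dt f v j) f"

text \<open>
  \<open>parareal G F J dt u0 f k n\<close> is \<open>U\<^sub>k\<^sup>n\<close>, for the coarse propagator \<open>G\<close> with step size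
  \<open>dT = J dt\<close> and the fine propagator \<open>F\<close> with step size \<open>dt\<close>.
\<close>

fun parareal ::
    "(real \<Rightarrow> real \<Rightarrow> 'h \<Rightarrow> (real \<Rightarrow> 'h) \<Rightarrow> 'h) \<Rightarrow> (real \<Rightarrow> real \<Rightarrow> 'h \<Rightarrow> (real \<Rightarrow> 'h) \<Rightarrow> 'h) \<Rightarrow>
     nat \<Rightarrow> real \<Rightarrow> 'h::real_vector \<Rightarrow> (real \<Rightarrow> 'h) \<Rightarrow> nat \<Rightarrow> nat \<Rightarrow> 'h"
  where
    "parareal G F J dt u0 f 0 0 = u0"
  | "parareal G F J dt u0 f 0 (Suc n) =
      (let dT = real J * dt in G (real n * dT) dT (parareal G F J dt u0 f 0 n) f)"
  | "parareal G F J dt u0 f (Suc k) 0 = u0"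
  | "parareal G F J dt u0 f (Suc k) (Suc n) =
      (let dT = real J * dt; t = real n * dT in
         G t dT (parareal G F J dt u0 f (Suc k) n) f
         + stepping F t dt f (parareal G F J dt u0 f k n) J
         - G t dT (parareal G F J dt u0 f k n) f)"

end

theory Submission
  imports Defs
begin

text \<open>
  The orthogonal projection onto an eigenspace of \<open>A\<close>, with eigenvalue \<open>l\<close>, turns every propagator
  into multiplication by numbers. Let \<open>s = l \<Delta>T\<close>, let \<open>g = 1 / (1 + s)\<close> be the factor of a coarse step
  and \<open>R = r(-s/J)\<^sup>J\<close> that of \<open>J\<close> fine steps. The fine solution is a fixed point of the parareal
  correction, hence the forcing drops out of the components \<open>e k n\<close> of the error, and
  \<open>e (k+1) (n+1) = g * e (k+1) n + (R - g) * e k n\<close>, with \<open>e (k+1) 0 = 0\<close>.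
  If \<open>|R - g| \<le> \<gamma> (1 - g)\<close>, the maximum over \<open>n\<close> shrinks by the factor \<open>\<gamma>\<close> in each iteration
  (\<open>two_level_contraction\<close>).

  The scalar estimate (\<open>lobatto_coarse_gap\<close>) is uniform in \<open>J\<close>: the inverse of \<open>R\<close> is the power
  \<open>(1 + x + x\<^sup>2/2)\<^sup>J\<close> with \<open>x = s/J\<close>, which lies between \<open>1 + s\<close> and \<open>e\<^sup>s\<close>. So \<open>R \<le> g\<close>, and the claim
  follows from the inequality \<open>1 - (1 + s) exp (- s) \<le> 0.31 s\<close>, in which \<open>0.31\<close> could be lowered
  to about \<open>0.2985\<close>.

  To return from components to the norm of the space, the maximum over \<open>n\<close> of the initial error has
  to be square summable over the spectrum, with a bound that does not depend on the grids. It is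
  majorized by sums over the time steps of the components of the data, and Minkowski's inequality
  yields the constant \<open>2 |u\<^sub>0| + 3 T max |f|\<close> (\<open>parareal_converges\<close>). That the components determine
  the norm, and that the resolvent in the coarse propagator exists and acts diagonally, rests on the
  spectral theorem: the eigenvectors of \<open>A\<close> are total (\<open>eigenvectors_total\<close>).
\<close>

section \<open>Orthogonal projections in Hilbert space\<close>

lemma norm_add_square:
  fixes x y :: "'a::real_inner"
  shows "(norm (x + y))\<^sup>2 = (norm x)\<^sup>2 + 2 * (x \<bullet> y) + (norm y)\<^sup>2"
  by (simp add: power2_norm_eq_inner inner_add inner_commute)

lemma norm_diff_square:
  fixes x y :: "'a::real_inner"
  shows "(norm (x - y))\<^sup>2 = (norm x)\<^sup>2 - 2 * (x \<bullet> y) + (norm y)\<^sup>2"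
  by (simp add: power2_norm_eq_inner inner_diff inner_commute)

text \<open>
  A minimizing sequence for the distance is Cauchy, and so converges, by the
  parallelogram identity, because the midpoint of two members of \<open>S\<close> is no closer to \<open>v\<close> than the
  infimum; and a minimizer has an orthogonal error, since otherwise a step along the offending
  direction would improve it.
\<close>

lemma projection_exists:
  fixes S :: "'a::{real_inner,complete_space} set"
  assumes S: "subspace S" "closed S"
  shows "\<exists>p\<in>S. \<forall>e\<in>S. (v - p) \<bullet> e = 0"
proof -
  define d where "d = (INF s\<in>S. (norm (v - s))\<^sup>2)"
  have ne: "S \<noteq> {}" and bdd: "bdd_below ((\<lambda>s. (norm (v - s))\<^sup>2) ` S)"
    using S subspace_0 by (auto intro!: bdd_belowI2[where m = 0])
  have d_le: "d \<le> (norm (v - s))\<^sup>2" if "s \<in> S" for s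
    unfolding d_def by (rule cINF_lower[OF bdd that])
  have "\<exists>s\<in>S. (norm (v - s))\<^sup>2 < d + 1 / real (Suc n)" for n
    using cINF_less_iff[OF ne bdd, of "d + 1 / real (Suc n)"] by (simp add: d_def)
  then obtain s where s: "\<And>n. s n \<in> S" "\<And>n. (norm (v - s n))\<^sup>2 < d + 1 / real (Suc n)"
    by metis
  have dist_s: "(norm (s m - s n))\<^sup>2 \<le> 2 / real (Suc m) + 2 / real (Suc n)" for m n
  proof -
    have "(1/2) *\<^sub>R (s m + s n) \<in> S"
      using S s by (intro subspace_scale subspace_add)
    then have "d \<le> (norm (v - (1/2) *\<^sub>R (s m + s n)))\<^sup>2"
      by (rule d_le)
    moreover have "(norm (s m - s n))\<^sup>2 = 2 * (norm (v - s m))\<^sup>2 + 2 * (norm (v - s n))\<^sup>2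
        - 4 * (norm (v - (1/2) *\<^sub>R (s m + s n)))\<^sup>2"
      unfolding power2_norm_eq_inner
      by (simp add: inner_diff inner_add inner_commute algebra_simps)
    ultimately show ?thesis
      using s(2)[of m] s(2)[of n] by simp
  qed
  have "Cauchy s"
  proof (rule metric_CauchyI)
    fix e :: real assume e: "e > 0"
    obtain M where M: "4 / e\<^sup>2 < real M"
      using reals_Archimedean2 by blast
    have "dist (s m) (s n) < e" if "m \<ge> M" "n \<ge> M" for m n
    proof -
      have small: "2 / real (Suc k) < e\<^sup>2 / 2" if "k \<ge> M" for k
      proof -
        have "4 / e\<^sup>2 < real (Suc k)"
          using M that by linarith
        then show ?thesis
          using e by (simp add: field_simps)
      qed
      have "(norm (s m - s n))\<^sup>2 < e\<^sup>2"
        using dist_s[of m n] small[OF that(1)] small[OF that(2)] by linarith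
      then have "norm (s m - s n) < e"
        by (rule power2_less_imp_less) (simp add: e less_imp_le)
      then show ?thesis
        by (simp add: dist_norm)
    qed
    then show "\<exists>M. \<forall>m\<ge>M. \<forall>n\<ge>M. dist (s m) (s n) < e" by blast
  qed
  then obtain p where p: "s \<longlonglongrightarrow> p"
    using Cauchy_convergent_iff convergent_def by blast
  have pS: "p \<in> S"
    using closed_sequentially[OF S(2)] s(1) p by blast
  have "(norm (v - p))\<^sup>2 \<le> d"
  proof (rule LIMSEQ_le)
    show "(\<lambda>n. (norm (v - s n))\<^sup>2) \<longlonglongrightarrow> (norm (v - p))\<^sup>2"
      by (intro tendsto_intros p)
    show "(\<lambda>n. d + 1 / real (Suc n)) \<longlonglongrightarrow> d"
      using tendsto_add[OF tendsto_const LIMSEQ_Suc[OF lim_1_over_n], of d] by simp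
    show "\<exists>N. \<forall>n\<ge>N. (norm (v - s n))\<^sup>2 \<le> d + 1 / real (Suc n)"
      using s(2) less_imp_le by blast
  qed
  then have min: "(norm (v - p))\<^sup>2 \<le> (norm (v - q))\<^sup>2" if "q \<in> S" for q
    using d_le[OF that] by linarith
  have "(v - p) \<bullet> e = 0" if e: "e \<in> S" for e
  proof (cases "e = 0")
    case False
    define t where "t = ((v - p) \<bullet> e) / (norm e)\<^sup>2"
    have "p + t *\<^sub>R e \<in> S"
      using S pS e by (intro subspace_add subspace_scale)
    from min[OF this] have "(norm (v - p))\<^sup>2 \<le> (norm ((v - p) - t *\<^sub>R e))\<^sup>2"
      by (simp add: algebra_simps)
    also have "\<dots> = (norm (v - p))\<^sup>2 - ((v - p) \<bullet> e)\<^sup>2 / (norm e)\<^sup>2"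
      unfolding norm_diff_square using False
      by (simp add: t_def power_mult_distrib power_divide power2_eq_square field_simps)
    finally show ?thesis
      using False by (simp add: divide_le_0_iff)
  qed simp
  with pS show ?thesis by blast
qed

lemma orth_proj_eqI:
  fixes S :: "'a::real_inner set"
  assumes S: "subspace S" and p: "p \<in> S" "\<And>e. e \<in> S \<Longrightarrow> (v - p) \<bullet> e = 0"
  shows "orth_proj S v = p"
  unfolding orth_proj_def
proof (rule the_equality)
  fix q assume q: "q \<in> S \<and> (\<forall>e\<in>S. (v - q) \<bullet> e = 0)"
  then have "q - p \<in> S"
    using S p by (simp add: subspace_diff)
  then have "(v - p) \<bullet> (q - p) - (v - q) \<bullet> (q - p) = 0"
    using q p by simp
  then have "(q - p) \<bullet> (q - p) = 0"
    by (simp add: inner_diff_left)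
  then show "q = p" by simp
qed (use p in blast)

section \<open>Orthogonal series\<close>

lemma norm_sum_orthogonal:
  fixes f :: "'i \<Rightarrow> 'a::real_inner"
  assumes "finite F" and "\<And>i j. i \<in> F \<Longrightarrow> j \<in> F \<Longrightarrow> i \<noteq> j \<Longrightarrow> f i \<bullet> f j = 0"
  shows "(norm (\<Sum>i\<in>F. f i))\<^sup>2 = (\<Sum>i\<in>F. (norm (f i))\<^sup>2)"
  using assms
proof (induction F rule: finite_induct)
  case (insert i F)
  then have "f i \<bullet> (\<Sum>j\<in>F. f j) = 0"
    by (auto simp: inner_sum_right intro!: sum.neutral)
  with insert show ?case
    by (simp add: norm_add_square)
qed simp

text \<open>
  Beyond a finite set that nearly exhausts the supremum of the sums of squares, every finite
  partial sum is small by the theorem of Pythagoras; so the partial sums form a Cauchy filter.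
\<close>

lemma summable_on_orthogonal:
  fixes f :: "'i \<Rightarrow> 'a::{real_inner,complete_space}"
  assumes orth: "\<And>i j. i \<in> I \<Longrightarrow> j \<in> I \<Longrightarrow> i \<noteq> j \<Longrightarrow> f i \<bullet> f j = 0"
    and bound: "\<And>F. finite F \<Longrightarrow> F \<subseteq> I \<Longrightarrow> (\<Sum>i\<in>F. (norm (f i))\<^sup>2) \<le> B"
  shows "f summable_on I"
proof -
  define FS where "FS = {F. finite F \<and> F \<subseteq> I}"
  define Q where "Q F = (\<Sum>i\<in>F. (norm (f i))\<^sup>2)" for F
  have ne: "FS \<noteq> {}" and bdd: "bdd_above (Q ` FS)"
    using bound by (auto simp: FS_def Q_def intro!: bdd_aboveI2[where M = B])
  have "\<exists>P. eventually P (finite_subsets_at_top I) \<and>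
            (\<forall>F F'. P F \<and> P F' \<longrightarrow> dist (sum f F) (sum f F') < e)" if e: "e > 0" for e
  proof -
    have "\<exists>F0\<in>FS. (SUP F\<in>FS. Q F) - (e/2)\<^sup>2 < Q F0"
      using e by (subst less_cSUP_iff[OF ne bdd, symmetric]) simp
    then obtain F0 where F0: "finite F0" "F0 \<subseteq> I" "(SUP F\<in>FS. Q F) - (e/2)\<^sup>2 < Q F0"
      by (auto simp: FS_def)
    have small: "norm (sum f F - sum f F0) < e/2" if F: "finite F" "F \<subseteq> I" "F0 \<subseteq> F" for F
    proof -
      have "Q F \<le> (SUP F\<in>FS. Q F)"
        using F by (intro cSUP_upper bdd) (auto simp: FS_def)
      moreover have "Q (F - F0) = Q F - Q F0"
        unfolding Q_def using F by (simp add: sum_diff)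
      moreover have "(norm (sum f F - sum f F0))\<^sup>2 = Q (F - F0)"
      proof -
        have "sum f F - sum f F0 = sum f (F - F0)"
          using F by (simp add: sum_diff)
        moreover have "(norm (sum f (F - F0)))\<^sup>2 = Q (F - F0)"
          unfolding Q_def using F by (intro norm_sum_orthogonal orth) auto
        ultimately show ?thesis by simp
      qed
      ultimately have "(norm (sum f F - sum f F0))\<^sup>2 < (e/2)\<^sup>2"
        using F0 by linarith
      moreover have "0 \<le> e/2" using e by simp
      ultimately show ?thesis by (rule power2_less_imp_less)
    qed
    have "dist (sum f F) (sum f F') < e"
      if "finite F \<and> F \<subseteq> I \<and> F0 \<subseteq> F" "finite F' \<and> F' \<subseteq> I \<and> F0 \<subseteq> F'" for F F'
    proof -
      have "dist (sum f F) (sum f F0) < e/2" "dist (sum f F') (sum f F0) < e/2"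
        using small that by (auto simp: dist_norm)
      then show ?thesis
        by (rule dist_triangle_half_l)
    qed
    moreover have "\<forall>\<^sub>F F in finite_subsets_at_top I. finite F \<and> F \<subseteq> I \<and> F0 \<subseteq> F"
      using F0 by (auto simp: eventually_finite_subsets_at_top)
    ultimately show ?thesis
      by (intro exI[of _ "\<lambda>F. finite F \<and> F \<subseteq> I \<and> F0 \<subseteq> F"] conjI) auto
  qed
  then have "cauchy_filter (filtermap (sum f) (finite_subsets_at_top I))"
    by (simp add: cauchy_filter_metric_filtermap)
  moreover have "complete (UNIV :: 'a set)"
    by (meson Cauchy_convergent UNIV_I complete_def convergent_def)
  ultimately obtain L where "(sum f \<longlongrightarrow> L) (finite_subsets_at_top I)"
    using complete_uniform[where S = UNIV] by (force simp add: filterlim_def)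
  then show ?thesis
    using summable_on_def has_sum_def by blast
qed

section \<open>Spectral theory of positive operators with compact inverse\<close>

locale discrete_positive_operator =
  fixes D :: "'h::{real_inner,complete_space} set" and A :: "'h \<Rightarrow> 'h"
  assumes linear: "linear_operator D A"
    and selfadjoint: "selfadjoint D A"
    and positive: "positive_definite D A"
    and compact_inverse: "has_compact_inverse D A"
begin

abbreviation E :: "real \<Rightarrow> 'h set" where "E \<equiv> eigenspace D A"
abbreviation P :: "real \<Rightarrow> 'h \<Rightarrow> 'h" where "P l \<equiv> orth_proj (E l)"
abbreviation eigenvalues :: "real set" where "eigenvalues \<equiv> {l. E l \<noteq> {0}}"

definition K :: "'h \<Rightarrow> 'h" where "K = inv_into D A"

lemma subspace_D: "subspace D"
  and A_add: "x \<in> D \<Longrightarrow> y \<in> D \<Longrightarrow> A (x + y) = A x + A y"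
  and A_scale: "x \<in> D \<Longrightarrow> A (a *\<^sub>R x) = a *\<^sub>R A x"
  using linear by (auto simp: linear_operator_def)

lemma A_symmetric:
  assumes "u \<in> D" "v \<in> D"
  shows "A u \<bullet> v = u \<bullet> A v"
proof -
  have "(v, A v) \<in> adjoint_graph D A"
    using selfadjoint assms by (auto simp: selfadjoint_def)
  then show ?thesis
    using assms by (simp add: adjoint_graph_def)
qed

lemma bij_A: "bij_betw A D UNIV"
  using compact_inverse by (simp add: has_compact_inverse_def)

lemma K_in_D: "K y \<in> D" and A_K: "A (K y) = y" and K_A: "x \<in> D \<Longrightarrow> K (A x) = x"
  using bij_A bij_betw_imp_surj_on[OF bij_A] inv_into_into[of y A D] f_inv_into_f[of y A D]
    inv_into_f_f[of A D x]
  by (auto simp: K_def bij_betw_def)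

lemma K_eqI: "x \<in> D \<Longrightarrow> A x = y \<Longrightarrow> K y = x"
  using K_A by blast

text \<open>
  The image of the unit ball has compact closure, so it is bounded.
\<close>

lemma bounded_linear_K: "bounded_linear K"
proof -
  have "compact (closure (K ` cball 0 1))"
    using compact_inverse by (simp add: has_compact_inverse_def K_def)
  then have "bounded (K ` cball 0 1)"
    by (rule bounded_subset[OF compact_imp_bounded closure_subset])
  then obtain B where "\<forall>y\<in>K ` cball 0 1. norm y \<le> B"
    unfolding bounded_iff ..
  then have B: "norm (K x) \<le> B" if "norm x \<le> 1" for x
    using that by simp
  have scale: "K (a *\<^sub>R x) = a *\<^sub>R K x" for a x
    by (rule K_eqI) (simp_all add: K_in_D A_K A_scale subspace_scale subspace_D)
  show ?thesis
  proof (rule bounded_linear_intro)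
    show "K (x + y) = K x + K y" for x y
      by (rule K_eqI) (simp_all add: K_in_D A_K A_add subspace_add subspace_D)
    show "norm (K x) \<le> norm x * B" for x
    proof (cases "x = 0")
      case True
      then show ?thesis using scale[of 0 0] by simp
    next
      case False
      have "norm (K x) = norm x * norm (K ((1 / norm x) *\<^sub>R x))"
        using False by (simp add: scale)
      also have "\<dots> \<le> norm x * B"
        using False by (intro mult_left_mono B) auto
      finally show ?thesis .
    qed
  qed (rule scale)
qed

interpretation K: bounded_linear K by (rule bounded_linear_K)

lemma K_symmetric: "K x \<bullet> y = x \<bullet> K y"
  using A_symmetric[OF K_in_D K_in_D, of x y] by (simp add: A_K)

lemma K_positive:
  assumes "x \<noteq> 0"
  shows "K x \<bullet> x > 0"
proof -
  have "K x \<noteq> 0"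
    using assms A_K[of x] A_K[of 0] K.zero by metis
  then show ?thesis
    using positive K_in_D[of x] by (auto simp: positive_definite_def A_K inner_commute)
qed

text \<open>
  Trading the unbounded \<open>A\<close> for its inverse exhibits each eigenspace as the kernel of a bounded
  operator, which makes it closed, so that it admits an orthogonal projection.
\<close>

lemma eigenspace_iff: "v \<in> E l \<longleftrightarrow> l *\<^sub>R K v = v"
proof
  assume "v \<in> E l"
  then have "v \<in> D" "A v = l *\<^sub>R v"
    by (simp_all add: eigenspace_def)
  then show "l *\<^sub>R K v = v"
    using K_A[of v] by (simp add: K.scaleR)
next
  assume v: "l *\<^sub>R K v = v"
  have "l *\<^sub>R K v \<in> D" "A (l *\<^sub>R K v) = l *\<^sub>R v"
    by (simp_all add: A_scale A_K K_in_D subspace_scale subspace_D)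
  then show "v \<in> E l"
    unfolding v by (simp add: eigenspace_def)
qed

lemma subspace_eigenspace: "subspace (E l)"
proof -
  have "E l = {v. l *\<^sub>R K v - v = 0}" by (auto simp: eigenspace_iff)
  moreover have "linear (\<lambda>v. l *\<^sub>R K v - v)"
    by (intro linear_compose_sub linear_compose_scale_right K.linear linear_ident)
  ultimately show ?thesis
    using linear_subspace_kernel[of "\<lambda>v. l *\<^sub>R K v - v"] by (simp only:)
qed

lemma closed_eigenspace: "closed (E l)"
proof -
  have "E l = {v. l *\<^sub>R K v = v}" by (auto simp: eigenspace_iff)
  then show ?thesis
    by (auto intro!: closed_Collect_eq continuous_intros K.continuous_on)
qed

lemma eigenvalue_pos:
  assumes "l \<in> eigenvalues"
  shows "l > 0"
proof -
  obtain v where v: "v \<in> E l" "v \<noteq> 0"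
    using assms subspace_0[OF subspace_eigenspace[of l]] by blast
  then have "v \<in> D" "A v = l *\<^sub>R v"
    by (simp_all add: eigenspace_def)
  moreover from this v have "0 < A v \<bullet> v"
    using positive unfolding positive_definite_def by blast
  ultimately have "0 < l * (v \<bullet> v)"
    by simp
  then show ?thesis
    by (rule zero_less_mult_pos2) (simp add: v)
qed

lemma eigenspaces_orthogonal:
  assumes "v \<in> E l" "w \<in> E m" "l \<noteq> m"
  shows "v \<bullet> w = 0"
proof -
  have "l * (v \<bullet> w) = m * (v \<bullet> w)"
    using A_symmetric[of v w] assms by (simp add: eigenspace_def)
  then show ?thesis using assms by simp
qed

lemma P_in: "P l v \<in> E l" and P_inner: "e \<in> E l \<Longrightarrow> P l v \<bullet> e = v \<bullet> e"
proof -
  obtain p where p: "p \<in> E l" "\<And>e. e \<in> E l \<Longrightarrow> (v - p) \<bullet> e = 0"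
    using projection_exists[OF subspace_eigenspace closed_eigenspace] by blast
  have eq: "P l v = p" by (rule orth_proj_eqI[OF subspace_eigenspace p])
  show "P l v \<in> E l" by (simp add: eq p)
  show "e \<in> E l \<Longrightarrow> P l v \<bullet> e = v \<bullet> e" using p(2)[of e] by (simp add: eq inner_diff_left)
qed

lemma P_eqI: "p \<in> E l \<Longrightarrow> (\<And>e. e \<in> E l \<Longrightarrow> p \<bullet> e = v \<bullet> e) \<Longrightarrow> P l v = p"
  by (rule orth_proj_eqI[OF subspace_eigenspace]) (simp_all add: inner_diff_left)

lemma P_add: "P l (v + w) = P l v + P l w"
  and P_diff: "P l (v - w) = P l v - P l w"
  and P_scaleR: "P l (a *\<^sub>R v) = a *\<^sub>R P l v"
  by (rule P_eqI; simp add: P_in P_inner subspace_add subspace_diff subspace_scale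
        subspace_eigenspace inner_add_left inner_diff_left)+

lemma P_zero: "P l 0 = 0"
  using P_scaleR[of l 0 0] by simp

lemma bessel:
  assumes F: "finite F"
  shows "(\<Sum>l\<in>F. (norm (P l v))\<^sup>2) \<le> (norm v)\<^sup>2"
proof -
  have "v \<bullet> P l v = (norm (P l v))\<^sup>2" for l
    using P_inner[OF P_in, of l v v] by (simp add: power2_norm_eq_inner)
  then have "(norm (v - (\<Sum>l\<in>F. P l v)))\<^sup>2 = (norm v)\<^sup>2 - (\<Sum>l\<in>F. (norm (P l v))\<^sup>2)"
    unfolding norm_diff_square
    using norm_sum_orthogonal[OF F, of "\<lambda>l. P l v"] eigenspaces_orthogonal[OF P_in P_in]
    by (simp add: inner_sum_right)
  then show ?thesis
    using zero_le_power2[of "norm (v - (\<Sum>l\<in>F. P l v))"] by linarith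
qed

text \<open>
  Otherwise the space \<open>W\<close> of vectors orthogonal to all eigenvectors is nontrivial, and \<open>K\<close> maps it to
  itself. With \<open>m\<close> the norm of \<open>K\<close> on \<open>W\<close>, unit vectors that nearly attain it are near eigenvectors of
  \<open>K\<^sup>2\<close> for \<open>m\<^sup>2\<close>, and compactness turns them into an exact one, \<open>z\<close>. Now \<open>(K + m) (K - m) z = 0\<close>,
  where \<open>K + m\<close> is injective because \<open>K\<close> is positive; so \<open>z\<close> is an eigenvector inside \<open>W\<close>. Going
  through \<open>K\<^sup>2\<close> avoids the variational characterization of \<open>m\<close> by the quadratic form of \<open>K\<close>.
\<close>

lemma eigenvectors_total:
  assumes "\<And>l e. e \<in> E l \<Longrightarrow> v \<bullet> e = 0"
  shows "v = 0"
proof (rule ccontr)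
  assume "v \<noteq> 0"
  define W where "W = {w. \<forall>l. \<forall>e\<in>E l. w \<bullet> e = 0}"
  have W: "subspace W" "v \<in> W"
    using assms by (auto simp: W_def subspace_def inner_add_left)
  have "W = (\<Inter>l. \<Inter>e\<in>E l. {w. w \<bullet> e = 0})" by (auto simp: W_def)
  then have closed: "closed W"
    by (auto intro!: closed_INT closed_Collect_eq continuous_intros)
  have K_W: "K w \<in> W" if "w \<in> W" for w
  proof -
    have "K w \<bullet> e = 0" if "e \<in> E l" for l e
    proof (cases "l = 0")
      case True
      then show ?thesis using that eigenspace_iff[of e l] by simp
    next
      case False
      have "l * (w \<bullet> K e) = w \<bullet> e"
        using that eigenspace_iff[of e l] inner_scaleR_right[of w l "K e"] by simp
      also have "\<dots> = 0" using \<open>w \<in> W\<close> that by (auto simp: W_def)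
      finally show ?thesis using False by (simp add: K_symmetric)
    qed
    then show ?thesis by (auto simp: W_def)
  qed
  define U where "U = {x \<in> W. norm x = 1}"
  define m where "m = (SUP x\<in>U. norm (K x))"
  define v1 where "v1 = (1 / norm v) *\<^sub>R v"
  have v1: "v1 \<in> U"
    using \<open>v \<noteq> 0\<close> W by (simp add: U_def v1_def subspace_scale)
  obtain B where B: "\<And>x. norm (K x) \<le> norm x * B" using K.bounded by blast
  have bdd: "bdd_above ((\<lambda>x. norm (K x)) ` U)"
    by (rule bdd_aboveI2[where M = B]) (metis (mono_tags, lifting) B U_def mem_Collect_eq mult_1)
  have m_ge: "norm (K x) \<le> m" if "x \<in> U" for x
    unfolding m_def by (rule cSUP_upper[OF that bdd])
  have "v1 \<noteq> 0"
    using v1 by (auto simp: U_def)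
  then have "K v1 \<noteq> 0"
    using K_positive[of v1] by auto
  then have m: "m > 0"
    using m_ge[OF v1] by (smt (verit) zero_less_norm_iff)
  have K_le: "norm (K x) \<le> m * norm x" if "x \<in> W" for x
  proof (cases "x = 0")
    case False
    have "(1 / norm x) *\<^sub>R x \<in> U"
      using that False W by (simp add: U_def subspace_scale)
    from m_ge[OF this] show ?thesis
      using False by (simp add: K.scaleR field_simps)
  qed (simp add: K.zero)
  have "\<exists>x\<in>U. m - 1 / real (Suc n) < norm (K x)" for n
    unfolding m_def by (subst less_cSUP_iff[OF _ bdd, symmetric]) (use v1 in auto)
  then obtain x where x: "\<And>n. x n \<in> U" "\<And>n. m - 1 / real (Suc n) < norm (K (x n))"
    by metis
  have Kx: "(\<lambda>n. norm (K (x n))) \<longlonglongrightarrow> m"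
  proof (rule tendsto_sandwich)
    show "(\<lambda>n. m - 1 / real (Suc n)) \<longlonglongrightarrow> m"
      using tendsto_diff[OF tendsto_const LIMSEQ_Suc[OF lim_1_over_n], of m] by simp
    show "\<forall>\<^sub>F n in sequentially. m - 1 / real (Suc n) \<le> norm (K (x n))"
      using x(2) by (simp add: less_imp_le)
    show "\<forall>\<^sub>F n in sequentially. norm (K (x n)) \<le> m"
      using m_ge x(1) by simp
  qed simp
  have "compact (closure (K ` cball 0 1))"
    using compact_inverse by (simp add: has_compact_inverse_def K_def)
  moreover have "K (x n) \<in> closure (K ` cball 0 1)" for n
    using x(1)[of n] by (intro subsetD[OF closure_subset]) (auto simp: U_def)
  ultimately obtain y r where "strict_mono r" "((\<lambda>n. K (x n)) \<circ> r) \<longlonglongrightarrow> y"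
    using compact_imp_seq_compact seq_compactE[of _ "\<lambda>n. K (x n)"] by metis
  then have r: "strict_mono r" "(\<lambda>n. K (x (r n))) \<longlonglongrightarrow> y"
    by (simp_all add: o_def)
  \<comment> \<open>Expand the square; the mixed term is \<open>K\<^sup>2 x \<bullet> x = |K x|\<^sup>2\<close> by symmetry.\<close>
  have near: "(norm (K (K (x n)) - m\<^sup>2 *\<^sub>R x n))\<^sup>2 \<le> m\<^sup>2 * (m\<^sup>2 - (norm (K (x n)))\<^sup>2)" for n
  proof -
    have xW: "x n \<in> W" "norm (x n) = 1" using x(1)[of n] by (auto simp: U_def)
    have "(norm (K (K (x n))))\<^sup>2 \<le> (m * norm (K (x n)))\<^sup>2"
      by (rule power_mono[OF K_le[OF K_W[OF xW(1)]]]) simp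
    moreover have "K (K (x n)) \<bullet> x n = (norm (K (x n)))\<^sup>2"
      by (simp add: K_symmetric[of "K (x n)"] power2_norm_eq_inner)
    ultimately show ?thesis
      unfolding norm_diff_square using xW
      by (simp add: power_mult_distrib algebra_simps)
  qed
  have "(\<lambda>n. K (K (x (r n))) - m\<^sup>2 *\<^sub>R x (r n)) \<longlonglongrightarrow> 0"
  proof -
    have *: "(\<lambda>n. m\<^sup>2 * (m\<^sup>2 - (norm (K (x (r n))))\<^sup>2)) \<longlonglongrightarrow> m\<^sup>2 * (m\<^sup>2 - m\<^sup>2)"
      by (intro tendsto_intros LIMSEQ_subseq_LIMSEQ[OF Kx r(1), unfolded o_def])
    have "(\<lambda>n. (norm (K (K (x (r n))) - m\<^sup>2 *\<^sub>R x (r n)))\<^sup>2) \<longlonglongrightarrow> 0"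
      by (rule tendsto_sandwich[where f = "\<lambda>_. 0" and h = "\<lambda>n. m\<^sup>2 * (m\<^sup>2 - (norm (K (x (r n))))\<^sup>2)"])
        (use near * in simp_all)
    then have "(\<lambda>n. sqrt ((norm (K (K (x (r n))) - m\<^sup>2 *\<^sub>R x (r n)))\<^sup>2)) \<longlonglongrightarrow> sqrt 0"
      by (rule tendsto_real_sqrt)
    then show ?thesis by (simp add: tendsto_norm_zero_iff)
  qed
  from tendsto_diff[OF K.tendsto[OF r(2)] this]
  have "(\<lambda>n. m\<^sup>2 *\<^sub>R x (r n)) \<longlonglongrightarrow> K y" by simp
  from tendsto_scaleR[OF tendsto_const this, of "1 / m\<^sup>2"]
  obtain z where z: "(\<lambda>n. x (r n)) \<longlonglongrightarrow> z" and z_eq: "z = (1 / m\<^sup>2) *\<^sub>R K y"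
    using m by simp
  have zW: "z \<in> W"
    by (rule closed_sequentially[OF closed _ z]) (use x(1) in \<open>auto simp: U_def\<close>)
  have "(\<lambda>n. norm (x (r n))) \<longlonglongrightarrow> norm z" by (intro tendsto_intros z)
  then have z1: "norm z = 1"
    using x(1) by (simp add: U_def LIMSEQ_const_iff)
  have "y = K z"
    by (rule LIMSEQ_unique[OF r(2) K.tendsto[OF z]])
  then have KK: "K (K z) = m\<^sup>2 *\<^sub>R z"
    using z_eq m by simp
  define w where "w = K z - m *\<^sub>R z"
  have "K w = - (m *\<^sub>R w)"
    by (simp add: w_def K.diff K.scaleR KK power2_eq_square algebra_simps)
  then have "w = 0"
    using K_positive[of w] m inner_ge_zero[of w] by (cases "w = 0") (auto simp: mult_less_0_iff)
  then have "z \<in> E (1 / m)"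
    using m by (simp add: eigenspace_iff w_def)
  then have "z \<bullet> z = 0"
    using zW by (auto simp: W_def)
  then show False using z1 by simp
qed

lemma eq_by_components:
  assumes "\<And>l. l \<in> eigenvalues \<Longrightarrow> P l v = P l w"
  shows "v = w"
proof -
  have "(v - w) \<bullet> e = 0" if e: "e \<in> E l" for l e
  proof (cases "l \<in> eigenvalues")
    case True
    then show ?thesis
      using assms[OF True] P_inner[OF e, of v] P_inner[OF e, of w] by (simp add: inner_diff_left)
  qed (use e in auto)
  then show ?thesis
    using eigenvectors_total[of "v - w"] by simp
qed

lemma spectral_fun_has_sum:
  assumes g: "\<And>l. l \<in> eigenvalues \<Longrightarrow> \<bar>g l\<bar> \<le> B"
  shows "((\<lambda>l. g l *\<^sub>R P l v) has_sum spectral_fun D A g v) eigenvalues"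
proof -
  have "(\<lambda>l. g l *\<^sub>R P l v) summable_on eigenvalues"
  proof (rule summable_on_orthogonal)
    show "(g i *\<^sub>R P i v) \<bullet> (g j *\<^sub>R P j v) = 0" if "i \<noteq> j" for i j
      using eigenspaces_orthogonal[OF P_in P_in that] by simp
    fix F assume F: "finite F" "F \<subseteq> eigenvalues"
    have "(\<Sum>i\<in>F. (norm (g i *\<^sub>R P i v))\<^sup>2) \<le> (\<Sum>i\<in>F. B\<^sup>2 * (norm (P i v))\<^sup>2)"
    proof (rule sum_mono)
      fix i assume "i \<in> F"
      then have "\<bar>g i\<bar>\<^sup>2 \<le> B\<^sup>2"
        using F g by (intro power_mono) auto
      then show "(norm (g i *\<^sub>R P i v))\<^sup>2 \<le> B\<^sup>2 * (norm (P i v))\<^sup>2"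
        by (simp add: power_mult_distrib mult_right_mono)
    qed
    also have "\<dots> \<le> B\<^sup>2 * (norm v)\<^sup>2"
      using bessel[OF F(1)] by (simp add: sum_distrib_left[symmetric] mult_left_mono)
    finally show "(\<Sum>i\<in>F. (norm (g i *\<^sub>R P i v))\<^sup>2) \<le> B\<^sup>2 * (norm v)\<^sup>2" .
  qed
  then show ?thesis
    unfolding spectral_fun_def by (rule has_sum_infsum)
qed

lemma P_spectral_fun:
  assumes g: "\<And>l. l \<in> eigenvalues \<Longrightarrow> \<bar>g l\<bar> \<le> B" and l: "l \<in> eigenvalues"
  shows "P l (spectral_fun D A g v) = g l *\<^sub>R P l v"
proof (rule P_eqI)
  show "g l *\<^sub>R P l v \<in> E l"
    by (intro subspace_scale subspace_eigenspace P_in)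
  fix e assume e: "e \<in> E l"
  have "((\<lambda>k. (g k *\<^sub>R P k v) \<bullet> e) has_sum (spectral_fun D A g v \<bullet> e)) eigenvalues"
    by (rule has_sum_bounded_linear[OF bounded_linear_inner_left spectral_fun_has_sum[OF g]])
  moreover have "((\<lambda>k. (g k *\<^sub>R P k v) \<bullet> e) has_sum ((g l *\<^sub>R P l v) \<bullet> e)) eigenvalues"
    by (rule has_sum_finite_neutralI[where B = "{l}"])
      (use l eigenspaces_orthogonal[OF P_in e] in auto)
  ultimately show "(g l *\<^sub>R P l v) \<bullet> e = spectral_fun D A g v \<bullet> e"
    by (rule has_sum_unique[symmetric])
qed

text \<open>
  The way back from estimates for single components to the Hilbert space norm: the partial sums of
  the eigenfunction expansion of \<open>v\<close> have exactly these norms, and they converge to \<open>v\<close> because the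
  eigenvectors are total.
\<close>

lemma norm_le_by_components:
  assumes "\<And>F. finite F \<Longrightarrow> F \<subseteq> eigenvalues \<Longrightarrow> L2_set (\<lambda>l. norm (P l v)) F \<le> C"
  shows "norm v \<le> C"
proof -
  have "spectral_fun D A (\<lambda>_. 1) v = v"
    by (rule eq_by_components) (simp add: P_spectral_fun[where B = 1])
  then have "((\<lambda>l. P l v) has_sum v) eigenvalues"
    using spectral_fun_has_sum[of "\<lambda>_. 1" 1 v] by simp
  then have lim: "((\<lambda>F. norm (\<Sum>l\<in>F. P l v)) \<longlongrightarrow> norm v) (finite_subsets_at_top eigenvalues)"
    unfolding has_sum_def by (rule tendsto_norm)
  have "norm (\<Sum>l\<in>F. P l v) \<le> C" if "finite F" "F \<subseteq> eigenvalues" for F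
  proof -
    have "norm (\<Sum>l\<in>F. P l v) = L2_set (\<lambda>l. norm (P l v)) F"
      unfolding L2_set_def
      using norm_sum_orthogonal[OF that(1), of "\<lambda>l. P l v"] eigenspaces_orthogonal[OF P_in P_in]
      by (metis norm_ge_zero real_sqrt_unique)
    then show ?thesis using assms[OF that] by simp
  qed
  then show ?thesis
    by (intro tendsto_upperbound[OF lim]) (auto intro: eventually_finite_subsets_at_top_weakI)
qed

lemma L2_components_le:
  assumes "finite F"
  shows "L2_set (\<lambda>l. norm (P l v)) F \<le> norm v"
  unfolding L2_set_def by (rule real_le_lsqrt) (simp_all add: bessel[OF assms])

lemma P_A:
  assumes "w \<in> D"
  shows "P l (A w) = l *\<^sub>R P l w"
proof (rule P_eqI)
  show "l *\<^sub>R P l w \<in> E l"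
    by (intro subspace_scale subspace_eigenspace P_in)
  show "(l *\<^sub>R P l w) \<bullet> e = A w \<bullet> e" if e: "e \<in> E l" for e
    using A_symmetric[OF assms, of e] P_inner[OF e, of w] e by (simp add: eigenspace_def)
qed

text \<open>
  The spectral formula is used for \<open>y = A w\<close> rather than for the solution \<open>w\<close>: setting \<open>w = K y\<close> then
  gives membership in \<open>D\<close> for free.
\<close>

lemma bij_resolvent:
  assumes d: "d > 0"
  shows "bij_betw (\<lambda>w. w + d *\<^sub>R A w) D UNIV"
proof -
  have pos1: "1 + d * l > 0" if "l \<in> eigenvalues" for l
    using eigenvalue_pos[OF that] d by (simp add: add_pos_pos)
  have surj: "\<exists>w\<in>D. w + d *\<^sub>R A w = x" for x
  proof -
    define y where "y = spectral_fun D A (\<lambda>l. l / (1 + d * l)) x"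
    have "\<bar>l / (1 + d * l)\<bar> \<le> 1 / d" if "l \<in> eigenvalues" for l
      using eigenvalue_pos[OF that] d pos1[OF that] by (simp add: field_simps)
    then have Py: "P l y = (l / (1 + d * l)) *\<^sub>R P l x" if "l \<in> eigenvalues" for l
      unfolding y_def using that by (rule P_spectral_fun)
    have "K y + d *\<^sub>R A (K y) = x"
    proof (rule eq_by_components)
      fix l assume l: "l \<in> eigenvalues"
      have "l *\<^sub>R P l (K y) = (l / (1 + d * l)) *\<^sub>R P l x"
        using P_A[OF K_in_D, of l y] Py[OF l] by (simp add: A_K)
      from arg_cong[OF this, of "\<lambda>z. (1 / l) *\<^sub>R z"] have "P l (K y) = (1 / (1 + d * l)) *\<^sub>R P l x"
        using eigenvalue_pos[OF l] by simp
      then have "P l (K y + d *\<^sub>R A (K y)) = (1 / (1 + d * l) + d * (l / (1 + d * l))) *\<^sub>R P l x"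
        by (simp add: P_add P_scaleR A_K Py[OF l] scaleR_add_left)
      also have "1 / (1 + d * l) + d * (l / (1 + d * l)) = 1"
        using pos1[OF l] by (simp add: add_divide_distrib[symmetric])
      finally show "P l (K y + d *\<^sub>R A (K y)) = P l x" by simp
    qed
    then show ?thesis using K_in_D by blast
  qed
  have "inj_on (\<lambda>w. w + d *\<^sub>R A w) D"
  proof (rule inj_onI)
    fix v w assume vw: "v \<in> D" "w \<in> D" "v + d *\<^sub>R A v = w + d *\<^sub>R A w"
    show "v = w"
    proof (rule eq_by_components)
      fix l assume l: "l \<in> eigenvalues"
      have "(1 + d * l) *\<^sub>R P l v = (1 + d * l) *\<^sub>R P l w"
        using arg_cong[OF vw(3), of "P l"] vw(1,2)
        by (simp add: P_add P_scaleR P_A scaleR_add_left)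
      then show "P l v = P l w" using pos1[OF l] by simp
    qed
  qed
  moreover have "(\<lambda>w. w + d *\<^sub>R A w) ` D = UNIV"
    using surj by (simp add: image_def set_eq_iff) metis
  ultimately show ?thesis by (simp add: bij_betw_def)
qed

lemma P_backward_euler:
  assumes d: "d > 0" and l: "l \<in> eigenvalues"
  shows "P l (backward_euler D A t d v f) = (1 / (1 + d * l)) *\<^sub>R (P l v + d *\<^sub>R P l (f t))"
proof -
  define w where "w = backward_euler D A t d v f"
  have "v + d *\<^sub>R f t \<in> (\<lambda>w. w + d *\<^sub>R A w) ` D"
    using bij_betw_imp_surj_on[OF bij_resolvent[OF d]] by simp
  from inv_into_into[OF this] f_inv_into_f[OF this]
  have w: "w \<in> D" "w + d *\<^sub>R A w = v + d *\<^sub>R f t"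
    by (simp_all add: w_def backward_euler_def)
  have "(1 + d * l) *\<^sub>R P l w = P l (w + d *\<^sub>R A w)"
    using w(1) by (simp add: P_add P_scaleR P_A scaleR_add_left)
  also have "\<dots> = P l v + d *\<^sub>R P l (f t)"
    unfolding w(2) by (simp add: P_add P_scaleR)
  finally have eq: "(1 + d * l) *\<^sub>R P l w = P l v + d *\<^sub>R P l (f t)" .
  moreover have "1 + d * l \<noteq> 0"
    using eigenvalue_pos[OF l] d by (simp add: add_pos_pos less_imp_neq[symmetric])
  ultimately show ?thesis
    by (simp add: w_def[symmetric] flip: eq)
qed

end

section \<open>The coefficients of the two-stage Lobatto IIIC method\<close>

lemma matrix_inv_eqI:
  fixes X Y :: "real^'n^'n"
  assumes "X ** Y = mat 1" "Y ** X = mat 1"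
  shows "matrix_inv X = Y"
  unfolding matrix_inv_def
proof (rule some_equality)
  fix Z assume "X ** Z = mat 1 \<and> Z ** X = mat 1"
  then show "Z = Y"
    by (metis assms(2) matrix_mul_assoc matrix_mul_lid matrix_mul_rid)
qed (use assms in blast)

lemma lobatto_resolvent:
  assumes "x \<ge> 0"
  shows "matrix_inv (mat 1 - (- x) *\<^sub>R lobatto_matrix) =
    (1 / (1 + x + x\<^sup>2 / 2)) *\<^sub>R vector [vector [1 + x/2, x/2], vector [- x/2, 1 + x/2]]"
proof -
  define d where "d = 1 + x + x\<^sup>2 / 2"
  have "d > 0" using assms by (simp add: d_def add_pos_nonneg)
  then have d: "d > 0" "d \<noteq> 0" by auto
  have e: "(1 + x/2) * (1 + x/2) + x/2 * (x/2) = d"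
    by (simp add: d_def power2_eq_square field_simps)
  show ?thesis
    unfolding d_def[symmetric]
    by (rule matrix_inv_eqI)
      (use d in \<open>simp_all add: vec_eq_iff forall_2 sum_2 matrix_matrix_mult_def mat_def
         lobatto_matrix_def divide_simps, simp_all add: d_def power2_eq_square algebra_simps\<close>)
qed

abbreviation lobatto_r :: "real \<Rightarrow> real" where
  "lobatto_r x \<equiv> rk_r lobatto_matrix lobatto_weights (- x)"

abbreviation lobatto_p :: "real \<Rightarrow> 2 \<Rightarrow> real" where
  "lobatto_p x i \<equiv> rk_p lobatto_matrix lobatto_weights (- x) $ i"

lemma lobatto_r_eq:
  assumes "x \<ge> 0"
  shows "lobatto_r x = 1 / (1 + x + x\<^sup>2 / 2)"
proof -
  have d: "1 + x + x\<^sup>2 / 2 > 0" using assms by (auto simp: add_pos_nonneg)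
  show ?thesis
    unfolding rk_r_def lobatto_resolvent[OF assms]
    using d by (simp add: lobatto_weights_def inner_vec_def sum_2 matrix_vector_mult_def divide_simps)
       (simp add: power2_eq_square algebra_simps)
qed

lemma lobatto_p_eq:
  assumes "x \<ge> 0"
  shows "lobatto_p x 1 = (1/2) / (1 + x + x\<^sup>2 / 2)"
    and "lobatto_p x 2 = ((1 + x) / 2) / (1 + x + x\<^sup>2 / 2)"
proof -
  have d: "1 + x + x\<^sup>2 / 2 > 0" using assms by (auto simp: add_pos_nonneg)
  show "lobatto_p x 1 = (1/2) / (1 + x + x\<^sup>2 / 2)"
    and "lobatto_p x 2 = ((1 + x) / 2) / (1 + x + x\<^sup>2 / 2)"
    unfolding rk_p_def lobatto_resolvent[OF assms]
    using d by (simp_all add: lobatto_weights_def sum_2 vector_matrix_mult_def divide_simps)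
qed

lemma lobatto_bounded:
  assumes x: "x \<ge> 0"
  shows "\<bar>lobatto_r x\<bar> \<le> 1" and "\<bar>lobatto_p x i\<bar> \<le> 1"
proof -
  define d where "d = 1 + x + x\<^sup>2 / 2"
  have d: "1 + x \<le> d" by (simp add: d_def)
  have bound: "\<bar>a / d\<bar> \<le> 1" if "0 \<le> a" "a \<le> 1 + x" for a
    using that d x by simp
  show "\<bar>lobatto_r x\<bar> \<le> 1"
    unfolding lobatto_r_eq[OF x] d_def[symmetric] using x by (intro bound) auto
  have "\<bar>lobatto_p x 1\<bar> \<le> 1" "\<bar>lobatto_p x 2\<bar> \<le> 1"
    unfolding lobatto_p_eq[OF x] d_def[symmetric] using x by (intro bound; simp)+
  then show "\<bar>lobatto_p x i\<bar> \<le> 1"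
    using exhaust_2[of i] by auto
qed

section \<open>The scalar contraction estimate\<close>

text \<open>
  The upper bound makes the slope \<open>- 7/4 exp (- 7/4)\<close> of \<open>(1 + s) exp (- s)\<close> at \<open>7/4\<close> at least \<open>- 31/100\<close>,
  and the lower one is what the tangent at \<open>7/4\<close> has to satisfy at \<open>s = 1\<close>. Fourth powers reduce
  both to decimal bounds for \<open>e\<close>.
\<close>

lemma exp_minus_7_4_bounds: "exp (-(7/4) :: real) \<le> 31/175" "exp (-(7/4) :: real) \<ge> 17/100"
proof -
  have e: "exp 1 > (27182/10000::real)" "exp 1 < (27183/10000::real)"
  proof -
    have "\<bar>exp 1 - 5837465777 / 2147483648\<bar> \<le> (1/10^6 :: real)"
      by (rule order_trans[OF e_approx_32]) simp
    then show "exp 1 > (27182/10000::real)" "exp 1 < (27183/10000::real)"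
      unfolding abs_le_iff by simp_all
  qed
  have *: "exp (7/4 :: real) ^ 4 = exp 1 ^ 7"
    by (simp flip: exp_of_nat_mult)
  have "(175/31::real) ^ 4 \<le> (27182/10000) ^ 7" by (simp add: field_simps)
  also have "\<dots> \<le> exp (7/4 :: real) ^ 4" unfolding * by (rule power_mono) (use e in auto)
  finally have "175/31 \<le> exp (7/4 :: real)" by (rule power_le_imp_le_base[of _ 3, simplified]) simp
  then show "exp (-(7/4) :: real) \<le> 31/175" by (simp add: exp_minus field_simps)
  have "exp (7/4 :: real) ^ 4 \<le> (27183/10000) ^ 7" unfolding * by (rule power_mono) (use e in auto)
  also have "\<dots> \<le> (100/17::real) ^ 4" by (simp add: field_simps)
  finally have "exp (7/4 :: real) \<le> 100/17" by (rule power_le_imp_le_base[of _ 3, simplified]) simp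
  then show "exp (-(7/4) :: real) \<ge> 17/100" by (simp add: exp_minus field_simps)
qed

lemma exp_minus_le_quadratic:
  fixes s :: real
  assumes "s \<ge> 0"
  shows "exp (- s) \<le> 1 - s + s\<^sup>2 / 2"
proof -
  have "1 \<le> 1 + s ^ 4 / 4"
    by simp
  also have "\<dots> = (1 - s + s\<^sup>2 / 2) * (1 + s + s\<^sup>2 / 2)"
    by (simp add: algebra_simps power2_eq_square power4_eq_xxxx)
  also have "\<dots> \<le> (1 - s + s\<^sup>2 / 2) * exp s"
  proof (rule mult_left_mono)
    show "1 + s + s\<^sup>2 / 2 \<le> exp s"
      using exp_lower_Taylor_quadratic[OF assms] by simp
    have "0 \<le> ((1 - s)\<^sup>2 + 1) / 2" by simp
    also have "\<dots> = 1 - s + s\<^sup>2 / 2" by (simp add: power2_eq_square field_simps)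
    finally show "0 \<le> 1 - s + s\<^sup>2 / 2" .
  qed
  finally show ?thesis
    by (simp add: exp_minus field_simps)
qed

text \<open>
  The quotient of \<open>1 - (1 + s) exp (- s)\<close> and \<open>s\<close> is largest near \<open>s = 1.79\<close>, where it is about \<open>0.2984\<close>. The
  function \<open>(1 + s) exp (- s)\<close> is convex from \<open>1\<close> on, so a tangent close to that point, at \<open>7/4\<close>, settles
  \<open>s \<ge> 1\<close>: its slope is nearly \<open>- 31/100\<close>, and little is lost where the inequality is tight. On
  \<open>[0, 1]\<close> a polynomial minorant of degree four is accurate enough.
\<close>

lemma coarse_exp_gap:
  fixes s :: real
  assumes "s \<ge> 0"
  shows "1 - (1 + s) * exp (- s) \<le> 31/100 * s"
proof (cases "s \<le> 1")
  case True
  define h where "h t = (1 + t) * exp (- t) - (1 - t\<^sup>2 / 2 + t ^ 3 / 3 - t ^ 4 / 8)" for t :: real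
  have "h 0 \<le> h s"
  proof (rule DERIV_nonneg_imp_nondecreasing[OF assms])
    fix t :: real assume t: "0 \<le> t" "t \<le> s"
    have "(h has_real_derivative t * (1 - t + t\<^sup>2 / 2 - exp (- t))) (at t)"
      unfolding h_def
      by (auto intro!: derivative_eq_intros simp: algebra_simps power2_eq_square power3_eq_cube)
    moreover have "0 \<le> t * (1 - t + t\<^sup>2 / 2 - exp (- t))"
      using t exp_minus_le_quadratic[of t] by simp
    ultimately show "\<exists>y. DERIV h t :> y \<and> y \<ge> 0" by blast
  qed
  then have "1 - (1 + s) * exp (- s) \<le> s * (s / 2 - s\<^sup>2 / 3 + s ^ 3 / 8)"
    by (simp add: h_def algebra_simps power2_eq_square power3_eq_cube power4_eq_xxxx)
  also have "\<dots> \<le> s * (31/100)"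
  proof (rule mult_left_mono[OF _ assms])
    \<comment> \<open>The cubic increases to \<open>7/24\<close> at \<open>1\<close>; the product is \<open>7/24\<close> minus the cubic.\<close>
    have "0 \<le> (1 - s) * ((4 + s) / 24 + (1 - s)\<^sup>2 / 8)"
      using True assms by (intro mult_nonneg_nonneg add_nonneg_nonneg) auto
    then show "s / 2 - s\<^sup>2 / 3 + s ^ 3 / 8 \<le> 31/100"
      by (simp add: field_simps power2_eq_square power3_eq_cube)
  qed
  finally show ?thesis by simp
next
  case False
  define h where "h t = (1 + t) * exp (- t)" for t :: real
  define q where "q = exp (-(7/4) :: real)"
  have "convex_on {1..} h"
  proof (rule f''_ge0_imp_convex)
    fix t :: real assume "t \<in> {1..}"
    show "DERIV h t :> - t * exp (- t)"
      unfolding h_def by (auto intro!: derivative_eq_intros simp: algebra_simps)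
    show "DERIV (\<lambda>t. - t * exp (- t)) t :> (t - 1) * exp (- t)"
      by (auto intro!: derivative_eq_intros simp: algebra_simps)
    show "0 \<le> (t - 1) * exp (- t)"
      using \<open>t \<in> {1..}\<close> by simp
  qed simp
  moreover have "(h has_real_derivative - (7/4) * q) (at (7/4) within {1..})"
    unfolding h_def q_def by (auto intro!: derivative_eq_intros simp: algebra_simps)
  ultimately have "h s - h (7/4) \<ge> - (7/4) * q * (s - 7/4)"
    using False by (intro convex_on_imp_above_tangent[where A = "{1..}"]) (auto simp: is_interval_connected)
  moreover have "h (7/4) = 11/4 * q"
    by (simp add: h_def q_def)
  moreover have "- (7/4) * q * (s - 7/4) = 49/16 * q - 7/4 * q * s"
    by (simp add: field_simps)
  ultimately have *: "h s \<ge> 93/16 * q - 7/4 * q * s"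
    by linarith
  have q: "q \<ge> 17/100" "q \<le> 31/175"
    using exp_minus_7_4_bounds by (auto simp: q_def)
  have "0 \<le> (31/100 - 7/4 * q) * (s - 1)"
    using q False by (intro mult_nonneg_nonneg) auto
  also have "\<dots> = 31/100 * s - 7/4 * q * s - 31/100 + 7/4 * q"
    by (simp add: field_simps)
  finally have "1 - 31/100 * s \<le> h s"
    using * q by linarith
  then show ?thesis
    by (simp add: h_def)
qed

text \<open>
  The inverse of the fine factor, \<open>(1 + x + x\<^sup>2/2)\<^sup>J\<close> with \<open>J x = s\<close>, lies between \<open>1 + s\<close> (Bernoulli) and
  \<open>e\<^sup>s\<close> (Taylor), whatever \<open>J\<close> is. So the fine factor never exceeds the coarse one, and the gap
  is at most that of the exact solution operator.
\<close>

lemma lobatto_coarse_gap: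
  fixes s :: real
  assumes s: "s \<ge> 0" and J: "J \<ge> 1"
  shows "\<bar>lobatto_r (s / real J) ^ J - 1 / (1 + s)\<bar> \<le> 0.31 * (1 - 1 / (1 + s))"
proof -
  define x where "x = s / real J"
  have x: "x \<ge> 0" "real J * x = s" using s J by (auto simp: x_def)
  have "1 + s \<le> 1 + real J * (x + x\<^sup>2 / 2)"
    using x by (simp add: distrib_left)
  also have "\<dots> \<le> (1 + (x + x\<^sup>2 / 2)) ^ J"
    using x by (intro Bernoulli_inequality) (simp add: add_nonneg_nonneg order_trans[of _ 0])
  finally have le: "1 + s \<le> (1 + x + x\<^sup>2 / 2) ^ J" by (simp add: add.assoc)
  have "(1 + x + x\<^sup>2 / 2) ^ J \<le> exp x ^ J"
    using x exp_lower_Taylor_quadratic[of x] by (intro power_mono) auto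
  also have "\<dots> = exp s" using x by (simp flip: exp_of_nat_mult)
  finally have ge: "(1 + x + x\<^sup>2 / 2) ^ J \<le> exp s" .
  define R where "R = (1 / (1 + x + x\<^sup>2 / 2)) ^ J"
  have R1: "R \<le> 1 / (1 + s)"
    unfolding R_def power_one_over using le s by (intro divide_left_mono) auto
  have "exp (- s) \<le> R"
    unfolding R_def power_one_over exp_minus inverse_eq_divide
    using le ge s by (intro divide_left_mono) auto
  then have "(1 - 31/100 * s) \<le> (1 + s) * R"
    using coarse_exp_gap[OF s] mult_left_mono[of "exp (- s)" R "1 + s"] s by linarith
  then have "(1 - 31/100 * s) / (1 + s) \<le> R"
    using s by (simp add: pos_divide_le_eq mult.commute)
  moreover have "1 / (1 + s) - (1 - 31/100 * s) / (1 + s) = 31/100 * (1 - 1 / (1 + s))"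
  proof -
    have "1 - 1 / (1 + s) = s / (1 + s)"
      using s by (simp add: field_simps)
    then show ?thesis
      by (simp add: diff_divide_distrib)
  qed
  ultimately have "1 / (1 + s) - R \<le> 31/100 * (1 - 1 / (1 + s))"
    by linarith
  then show ?thesis
    using R1 lobatto_r_eq[OF x(1)] by (simp add: R_def x_def)
qed

section \<open>Convergence of parareal\<close>

lemma stepping_add:
  "stepping F t dt f v (i + j) = stepping F (t + real i * dt) dt f (stepping F t dt f v i) j"
  by (induction j) (simp_all add: algebra_simps)

text \<open>
  Each step in \<open>n\<close> weighs the current iterate with \<open>g\<close> and the previous one with at most
  \<open>\<gamma> (1 - g)\<close>, so a bound smaller by the factor \<open>\<gamma>\<close> reproduces itself:
  \<open>g \<gamma> + \<gamma> (1 - g) = \<gamma>\<close>.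
\<close>

lemma two_level_contraction:
  fixes e :: "nat \<Rightarrow> nat \<Rightarrow> 'a::real_normed_vector"
  assumes e0: "\<And>k. e (Suc k) 0 = 0"
    and rec: "\<And>k n. e (Suc k) (Suc n) = g *\<^sub>R e (Suc k) n + (R - g) *\<^sub>R e k n"
    and g: "0 \<le> g" and gap: "\<bar>R - g\<bar> \<le> \<gamma> * (1 - g)" and \<gamma>: "0 \<le> \<gamma>"
    and start: "\<And>n. n \<le> N \<Longrightarrow> norm (e 0 n) \<le> B"
    and n: "n \<le> N"
  shows "norm (e k n) \<le> \<gamma> ^ k * B"
  using n
proof (induction k arbitrary: n)
  case 0
  then show ?case using start by simp
next
  case (Suc k)
  have B: "0 \<le> B"
    using start[of 0] norm_ge_zero[of "e 0 0"] by linarith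
  show ?case
    using Suc.prems
  proof (induction n)
    case 0
    then show ?case using e0 \<gamma> B by simp
  next
    case (Suc n)
    have "norm (e (Suc k) (Suc n)) \<le> g * norm (e (Suc k) n) + \<bar>R - g\<bar> * norm (e k n)"
      unfolding rec using g norm_triangle_ineq[of "g *\<^sub>R e (Suc k) n" "(R - g) *\<^sub>R e k n"] by simp
    also have "\<dots> \<le> g * (\<gamma> ^ Suc k * B) + (\<gamma> * (1 - g)) * (\<gamma> ^ k * B)"
      using Suc \<open>\<And>n. n \<le> N \<Longrightarrow> norm (e k n) \<le> \<gamma> ^ k * B\<close> g gap
      by (intro add_mono mult_left_mono mult_mono) auto
    also have "\<dots> = \<gamma> ^ Suc k * B"
      by (simp add: algebra_simps)
    finally show ?case .
  qed
qed

context discrete_positive_operator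
begin

lemma P_lobatto:
  assumes dt: "dt \<ge> 0" and l: "l \<in> eigenvalues"
  shows "P l (lobatto_propagator D A t dt v f) =
    lobatto_r (dt * l) *\<^sub>R P l v +
    dt *\<^sub>R (lobatto_p (dt * l) 1 *\<^sub>R P l (f t) + lobatto_p (dt * l) 2 *\<^sub>R P l (f (t + dt)))"
proof -
  have x: "dt * m \<ge> 0" if "m \<in> eigenvalues" for m
    using dt eigenvalue_pos[OF that] by simp
  have "P l (spectral_fun D A (\<lambda>m. lobatto_r (dt * m)) w) = lobatto_r (dt * l) *\<^sub>R P l w" for w
    by (rule P_spectral_fun[where B = 1, OF _ l]) (rule lobatto_bounded[OF x])
  moreover have "P l (spectral_fun D A (\<lambda>m. lobatto_p (dt * m) i) w) =
      lobatto_p (dt * l) i *\<^sub>R P l w" for w i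
    by (rule P_spectral_fun[where B = 1, OF _ l]) (rule lobatto_bounded[OF x])
  ultimately show ?thesis
    by (simp add: lobatto_propagator_def rk_propagator_def sum_2 lobatto_nodes_def P_add P_scaleR)
qed

lemma P_stepping_diff:
  assumes "dt \<ge> 0" and "l \<in> eigenvalues"
  shows "P l (stepping (lobatto_propagator D A) t dt f v j) -
      P l (stepping (lobatto_propagator D A) t dt f w j) =
    lobatto_r (dt * l) ^ j *\<^sub>R (P l v - P l w)"
proof (induction j)
  case (Suc j)
  show ?case
    by (simp add: P_lobatto[OF assms] Suc flip: scaleR_diff_right scaleR_scaleR)
qed simp

text \<open>
  The maximum over the time levels does not commute with the sum of squares over the spectrum.
  Therefore the components are first bounded by majorants that serve all time levels at once, and
  these majorants are summed over the spectrum, where Minkowski's inequality handles sums over time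
  steps.
\<close>

definition square_sum_le :: "(real \<Rightarrow> real) \<Rightarrow> real \<Rightarrow> bool" where
  "square_sum_le b C \<longleftrightarrow> (\<forall>F. finite F \<longrightarrow> L2_set b F \<le> C)"

lemma square_sum_le_P: "norm v \<le> C \<Longrightarrow> square_sum_le (\<lambda>l. norm (P l v)) C"
  unfolding square_sum_le_def using order_trans[OF L2_components_le] by blast

lemma square_sum_le_add:
  "square_sum_le a C \<Longrightarrow> square_sum_le b C' \<Longrightarrow> square_sum_le (\<lambda>l. a l + b l) (C + C')"
  unfolding square_sum_le_def by (blast intro: order_trans[OF L2_set_triangle_ineq] add_mono)

lemma square_sum_le_mult:
  assumes "square_sum_le a C" and "r \<ge> 0"
  shows "square_sum_le (\<lambda>l. r * a l) (r * C)"
  using assms by (simp add: square_sum_le_def L2_set_right_distrib[symmetric] mult_left_mono)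

lemma square_sum_le_sum:
  assumes "\<And>i. i < n \<Longrightarrow> square_sum_le (a i) C"
  shows "square_sum_le (\<lambda>l. \<Sum>i<n. a i l) (real n * C)"
  using assms
proof (induction n)
  case 0
  then show ?case by (simp add: square_sum_le_def L2_set_def)
next
  case (Suc n)
  then have "square_sum_le (\<lambda>l. (\<Sum>i<n. a i l) + a n l) (real n * C + C)"
    by (intro square_sum_le_add) auto
  then show ?case by (simp add: algebra_simps)
qed

text \<open>
  Stability of the scheme with all coefficient functions bounded by \<open>1\<close>. The right-hand side grows
  with \<open>n\<close>, so its value at the last time level majorizes all earlier ones.
\<close>

lemma norm_P_lobatto_stepping:
  assumes dt: "dt \<ge> 0" and l: "l \<in> eigenvalues"
  shows "norm (P l (stepping (lobatto_propagator D A) 0 dt f v n)) \<le>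
    norm (P l v) + dt * (\<Sum>i<n. norm (P l (f (real i * dt))) + norm (P l (f (real (Suc i) * dt))))"
proof (induction n)
  case (Suc n)
  let ?x = "dt * l" and ?u = "P l (stepping (lobatto_propagator D A) 0 dt f v n)"
  let ?a = "P l (f (real n * dt))" and ?b = "P l (f (real (Suc n) * dt))"
  have x: "?x \<ge> 0" using dt eigenvalue_pos[OF l] by simp
  have c: "norm (lobatto_r ?x *\<^sub>R w) \<le> norm w" "norm (lobatto_p ?x i *\<^sub>R w) \<le> norm w" for i and w :: 'h
    using mult_right_mono[OF lobatto_bounded(1)[OF x] norm_ge_zero[of w]]
      mult_right_mono[OF lobatto_bounded(2)[OF x] norm_ge_zero[of w]] by simp_all
  have eq: "P l (stepping (lobatto_propagator D A) 0 dt f v (Suc n)) =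
      lobatto_r ?x *\<^sub>R ?u + dt *\<^sub>R (lobatto_p ?x 1 *\<^sub>R ?a + lobatto_p ?x 2 *\<^sub>R ?b)"
    by (simp add: P_lobatto[OF dt l] algebra_simps)
  have b: "norm (dt *\<^sub>R (lobatto_p ?x 1 *\<^sub>R ?a + lobatto_p ?x 2 *\<^sub>R ?b)) \<le> dt * (norm ?a + norm ?b)"
  proof -
    have "norm (lobatto_p ?x 1 *\<^sub>R ?a + lobatto_p ?x 2 *\<^sub>R ?b) \<le> norm ?a + norm ?b"
      using norm_triangle_ineq c(2)[of 1 ?a] c(2)[of 2 ?b] by (rule order_trans[OF _ add_mono])
    from mult_left_mono[OF this dt] show ?thesis
      unfolding norm_scaleR[of dt] abs_of_nonneg[OF dt] .
  qed
  have "norm (P l (stepping (lobatto_propagator D A) 0 dt f v (Suc n)))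
      \<le> norm ?u + dt * (norm ?a + norm ?b)"
    unfolding eq by (rule norm_triangle_le, rule add_mono[OF c(1) b])
  also have "\<dots> \<le> norm (P l v) + dt * (\<Sum>i<Suc n. norm (P l (f (real i * dt))) + norm (P l (f (real (Suc i) * dt))))"
    using Suc.IH by (simp add: distrib_left)
  finally show ?case .
qed simp

lemma norm_P_coarse:
  assumes "real J * dt > 0" and l: "l \<in> eigenvalues"
  shows "norm (P l (parareal (backward_euler D A) F J dt v f 0 n)) \<le>
    norm (P l v) + (real J * dt) * (\<Sum>i<n. norm (P l (f (real i * (real J * dt)))))"
proof (induction n)
  case (Suc n)
  let ?dT = "real J * dt" and ?U = "parareal (backward_euler D A) F J dt v f 0 n"
  let ?a = "P l (f (real n * ?dT))"
  have "0 < ?dT * l"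
    using assms(1) eigenvalue_pos[OF l] by (rule mult_pos_pos)
  then have g: "0 \<le> 1 / (1 + ?dT * l)" "1 / (1 + ?dT * l) \<le> 1"
    by (simp_all add: divide_le_eq)
  have "P l (parareal (backward_euler D A) F J dt v f 0 (Suc n)) =
      (1 / (1 + ?dT * l)) *\<^sub>R (P l ?U + ?dT *\<^sub>R ?a)"
    unfolding parareal.simps Let_def by (rule P_backward_euler[OF assms])
  also have "norm \<dots> \<le> norm (P l ?U + ?dT *\<^sub>R ?a)"
    using mult_right_mono[OF g(2) norm_ge_zero] g(1) by simp
  also have "\<dots> \<le> norm (P l ?U) + ?dT * norm ?a"
    using assms(1) norm_triangle_ineq[of "P l ?U" "?dT *\<^sub>R ?a"] by simp
  also have "\<dots> \<le> norm (P l v) + ?dT * (\<Sum>i<Suc n. norm (P l (f (real i * ?dT))))"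
    using Suc.IH by (simp add: distrib_left)
  finally show ?case .
qed simp

text \<open>
  The fine solution is a fixed point of the parareal correction, and the forcing terms are the same
  in all propagators; so only the linear parts survive in the error recursion.
\<close>

lemma parareal_component_error:
  fixes v :: 'h and f :: "real \<Rightarrow> 'h"
  assumes dt: "dt > 0" and J: "J \<ge> 1" and l: "l \<in> eigenvalues"
  defines "U \<equiv> parareal (backward_euler D A) (lobatto_propagator D A) J dt v f"
    and "u \<equiv> stepping (lobatto_propagator D A) 0 dt f v"
    and "dT \<equiv> real J * dt"
  assumes start: "\<And>n. n \<le> N \<Longrightarrow> norm (P l (U 0 n - u (n * J))) \<le> B" and n: "n \<le> N"
  shows "norm (P l (U k n - u (n * J))) \<le> 0.31 ^ k * B"
proof -
  define g where "g = 1 / (1 + dT * l)"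
  define R where "R = lobatto_r (dt * l) ^ J"
  have dT: "dT > 0" using dt J by (simp add: dT_def)
  have s: "dT * l > 0" using dT eigenvalue_pos[OF l] by simp
  have gap: "\<bar>R - g\<bar> \<le> 0.31 * (1 - g)"
    using lobatto_coarse_gap[of "dT * l" J] s J by (simp add: R_def g_def dT_def)
  show ?thesis
  proof (rule two_level_contraction[where e = "\<lambda>k n. P l (U k n - u (n * J))" and g = g and R = R, OF _ _ _ gap _ start n])
    show "P l (U (Suc k) 0 - u (0 * J)) = 0" for k
      by (simp add: U_def u_def P_zero)
    show "P l (U (Suc k) (Suc n) - u (Suc n * J)) =
        g *\<^sub>R P l (U (Suc k) n - u (n * J)) + (R - g) *\<^sub>R P l (U k n - u (n * J))" for k n
    proof -
      let ?t = "real n * dT"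
      let ?L = "\<lambda>v. stepping (lobatto_propagator D A) ?t dt f v J"
      have u: "u (Suc n * J) = ?L (u (n * J))"
        using stepping_add[of "lobatto_propagator D A" 0 dt f v "n * J" J]
        by (simp add: u_def dT_def add.commute mult.assoc)
      have step: "U (Suc k) (Suc n) = backward_euler D A ?t dT (U (Suc k) n) f + ?L (U k n)
          - backward_euler D A ?t dT (U k n) f"
        by (simp add: U_def dT_def Let_def)
      have "P l (U (Suc k) (Suc n) - u (Suc n * J)) =
          g *\<^sub>R (P l (U (Suc k) n) - P l (U k n)) + (P l (?L (U k n)) - P l (?L (u (n * J))))"
        unfolding u step by (simp add: P_add P_diff P_backward_euler[OF dT l] g_def algebra_simps)
      also have "\<dots> = g *\<^sub>R (P l (U (Suc k) n) - P l (U k n)) + R *\<^sub>R (P l (U k n) - P l (u (n * J)))"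
        using P_stepping_diff[OF less_imp_le[OF dt] l] by (simp add: R_def)
      finally show ?thesis
        by (simp add: P_diff algebra_simps)
    qed
    show "0 \<le> g" using s by (simp add: g_def)
  qed simp_all
qed

text \<open>
  In the constant, \<open>2 |v|\<close> stems from the two trajectories in the initial error; the coarse
  trajectory sees the forcing once per step, and the fine one twice, once for each stage.
\<close>

lemma parareal_converges:
  fixes v :: 'h and f :: "real \<Rightarrow> 'h"
  assumes dt: "dt > 0" and J: "J \<ge> 1"
    and f: "\<And>t. 0 \<le> t \<Longrightarrow> t \<le> real (J * Nc) * dt \<Longrightarrow> norm (f t) \<le> C"
    and n: "n \<le> Nc"
  shows "norm (parareal (backward_euler D A) (lobatto_propagator D A) J dt v f k n
      - stepping (lobatto_propagator D A) 0 dt f v (n * J))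
    \<le> (2 * norm v + 3 * (real (J * Nc) * dt * C)) * 0.31 ^ k"
proof -
  define dT where "dT = real J * dt"
  define U where "U = parareal (backward_euler D A) (lobatto_propagator D A) J dt v f"
  define u where "u = stepping (lobatto_propagator D A) 0 dt f v"
  define BU where "BU l = norm (P l v) + dT * (\<Sum>i<Nc. norm (P l (f (real i * dT))))" for l
  define Bu where "Bu l = norm (P l v) +
    dt * (\<Sum>i<Nc * J. norm (P l (f (real i * dt))) + norm (P l (f (real (Suc i) * dt))))" for l
  have dT: "dT > 0" using dt J by (simp add: dT_def)
  have T: "real (J * Nc) * dt = real Nc * dT" by (simp add: dT_def)
  have "square_sum_le BU (norm v + dT * (real Nc * C))"
    unfolding BU_def
  proof (intro square_sum_le_add square_sum_le_mult square_sum_le_sum square_sum_le_P f)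
    show "real i * dT \<le> real (J * Nc) * dt" if "i < Nc" for i
      unfolding T using that dT by (intro mult_right_mono) auto
  qed (use dT in auto)
  moreover have "square_sum_le Bu (norm v + dt * (real (Nc * J) * (C + C)))"
    unfolding Bu_def
  proof (intro square_sum_le_add square_sum_le_mult square_sum_le_sum square_sum_le_P f)
    show "real i * dt \<le> real (J * Nc) * dt" "real (Suc i) * dt \<le> real (J * Nc) * dt"
      if "i < Nc * J" for i
      using that dt by (auto simp: mult.commute[of J] intro!: mult_right_mono simp del: of_nat_Suc of_nat_mult)
  qed (use dt in auto)
  ultimately have "square_sum_le (\<lambda>l. BU l + Bu l)
      (norm v + dT * (real Nc * C) + (norm v + dt * (real (Nc * J) * (C + C))))"
    by (rule square_sum_le_add)
  also have "norm v + dT * (real Nc * C) + (norm v + dt * (real (Nc * J) * (C + C))) =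
      2 * norm v + 3 * (real (J * Nc) * dt * C)"
    by (simp add: dT_def algebra_simps)
  finally have total: "square_sum_le (\<lambda>l. BU l + Bu l) (2 * norm v + 3 * (real (J * Nc) * dt * C))" .
  have start: "norm (P l (U 0 n - u (n * J))) \<le> BU l + Bu l"
    if l: "l \<in> eigenvalues" and n: "n \<le> Nc" for l n
  proof -
    have "norm (P l (U 0 n)) \<le> norm (P l v) + dT * (\<Sum>i<n. norm (P l (f (real i * dT))))"
      using norm_P_coarse[of J dt l] dT l by (simp add: U_def dT_def)
    also have "\<dots> \<le> BU l"
      unfolding BU_def using n dT by (intro add_left_mono mult_left_mono sum_mono2) auto
    finally have 1: "norm (P l (U 0 n)) \<le> BU l" .
    have "norm (P l (u (n * J))) \<le> norm (P l v) +
        dt * (\<Sum>i<n * J. norm (P l (f (real i * dt))) + norm (P l (f (real (Suc i) * dt))))"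
      unfolding u_def using dt l by (intro norm_P_lobatto_stepping) auto
    also have "\<dots> \<le> Bu l"
    proof -
      have "n * J \<le> Nc * J" using n by simp
      then show ?thesis
        unfolding Bu_def using dt by (intro add_left_mono mult_left_mono sum_mono2) auto
    qed
    finally have "norm (P l (u (n * J))) \<le> Bu l" .
    with 1 show ?thesis
      unfolding P_diff using norm_triangle_ineq4[of "P l (U 0 n)" "P l (u (n * J))"] by linarith
  qed
  have "norm (U k n - u (n * J)) \<le> 0.31 ^ k * (2 * norm v + 3 * (real (J * Nc) * dt * C))"
  proof (rule norm_le_by_components)
    fix F :: "real set" assume F: "finite F" "F \<subseteq> eigenvalues"
    have "L2_set (\<lambda>l. norm (P l (U k n - u (n * J)))) F \<le> L2_set (\<lambda>l. 0.31 ^ k * (BU l + Bu l)) F"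
    proof (rule L2_set_mono)
      fix l assume "l \<in> F"
      then have l: "l \<in> eigenvalues" using F by blast
      show "norm (P l (U k n - u (n * J))) \<le> 0.31 ^ k * (BU l + Bu l)"
        unfolding U_def u_def
        by (rule parareal_component_error[OF dt J l start[OF l, unfolded U_def u_def] n])
    qed simp
    also have "\<dots> \<le> 0.31 ^ k * (2 * norm v + 3 * (real (J * Nc) * dt * C))"
      using square_sum_le_mult[OF total, of "0.31 ^ k"] F by (simp add: square_sum_le_def)
    finally show "L2_set (\<lambda>l. norm (P l (U k n - u (n * J)))) F
        \<le> 0.31 ^ k * (2 * norm v + 3 * (real (J * Nc) * dt * C))" .
  qed
  then show ?thesis
    by (simp add: U_def u_def mult.commute)
qed

end

theorem proposition4p2:
  fixes D :: "'h::{real_inner,complete_space} set"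
    and A :: "'h \<Rightarrow> 'h"
    and T :: real
    and u0 :: 'h
    and f :: "real \<Rightarrow> 'h"
  assumes "linear_operator D A"
    and "densely_defined D"
    and "selfadjoint D A"
    and "positive_definite D A"
    and "has_compact_inverse D A"
    and "T > 0"
    and "continuous_on {0..T} f"
  shows "\<exists>c::real. \<forall>J\<ge>2. \<forall>Nc\<ge>1. \<forall>k::nat.
           let dt = T / real (J * Nc);
               u = stepping (lobatto_propagator D A) 0 dt f u0;
               U = parareal (backward_euler D A) (lobatto_propagator D A) J dt u0 f
           in (MAX n\<in>{1..Nc}. norm (U k n - u (n * J))) \<le> c * 0.31 ^ k"
proof -
  interpret discrete_positive_operator D A
    using assms by unfold_locales
  have "compact (f ` {0..T})"
    using assms(7) by (intro compact_continuous_image) auto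
  then have "bounded (f ` {0..T})"
    by (rule compact_imp_bounded)
  then obtain C where C: "\<forall>y\<in>f ` {0..T}. norm y \<le> C"
    unfolding bounded_iff ..
  have main: "norm (parareal (backward_euler D A) (lobatto_propagator D A) J (T / real (J * Nc)) u0 f k n
      - stepping (lobatto_propagator D A) 0 (T / real (J * Nc)) f u0 (n * J))
    \<le> (2 * norm u0 + 3 * (T * C)) * 0.31 ^ k" if "J \<ge> 2" "Nc \<ge> 1" "n \<le> Nc" for J Nc k n
  proof -
    have JN: "real (J * Nc) > 0"
      using that by simp
    then have T: "real (J * Nc) * (T / real (J * Nc)) = T"
      using that by simp
    show ?thesis
      using parareal_converges[of "T / real (J * Nc)" J Nc f C n u0 k, unfolded T]
        that JN \<open>T > 0\<close> C by simp
  qed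
  show ?thesis
  proof (intro exI[of _ "2 * norm u0 + 3 * (T * C)"] allI impI, unfold Let_def)
    fix J Nc k :: nat assume "2 \<le> J" "1 \<le> Nc"
    then show "(MAX n\<in>{1..Nc}. norm (parareal (backward_euler D A) (lobatto_propagator D A) J
          (T / real (J * Nc)) u0 f k n
        - stepping (lobatto_propagator D A) 0 (T / real (J * Nc)) f u0 (n * J)))
      \<le> (2 * norm u0 + 3 * (T * C)) * 0.31 ^ k"
      by (intro Max.boundedI) (use main[of J Nc _ k] in \<open>auto simp del: of_nat_mult\<close>)
  qed
qed

end
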